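(* Let $D\subset\mathbb{R}^2$ be a domain lying in the half-space $\{(x_1,x_2)\in\mathbb{R}^2 : x_2>0\}$ and satisfying the following condition: there exists a point $(a_1,a_2)\in D$ with the property that for every $k\in\mathbb{N}$ one can find an affine function $\gamma_k(t)=c_kt+d_k$ (with $c_k,d_k\in\mathbb{R}$) such that $(t,\gamma_k(t))\in D$ and $|\gamma_k(t)-a_2|\le 1/k$ for all $t\in[-k,k]$. Then the tube domain $T_D=D+i\mathbb{R}^2\subset\mathbb{C}^2$ is not Kobayashi-hyperbolic.
   Context: A domain is a nonempty connected open set, and $\mathbb{N}=\{1,2,3,\dots\}$. For a domain $D\subset\mathbb{R}^2$, the tube domain with base $D$ is $T_D:=D+i\mathbb{R}^2=\{(z_1,z_2)\in\mathbb{C}^2 : (\operatorname{Re} z_1,\operatorname{Re} z_2)\in D\}$. A connected complex manifold $X$ is Kobayashi-hyperbolic if the Kobayashi pseudodistance on $X$ is a distance. Equivalently, for $X$ endowed with a Riemannian metric: for every point $x\in X$ there exist a neighborhood $U$ of $x$ and a constant $M>0$ such that for all holomorphic maps $f:\Delta\to X$ with $f(0)\in U$ one has $\|df(0)\|<M$, where $\Delta$ is the unit disk in $\mathbb{C}$. *)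

theory Defs
  imports "HOL-Complex_Analysis.Complex_Analysis"
begin

definition is_domain :: "'a::topological_space set \<Rightarrow> bool" where
  "is_domain X \<longleftrightarrow> X \<noteq> {} \<and> open X \<and> connected X"

definition tube :: "(real ^ 'n) set \<Rightarrow> (complex ^ 'n) set" where
  "tube D = {z. (\<chi> i. Re (z $ i)) \<in> D}"

definition holomorphic_discs :: "(complex ^ 'n) set \<Rightarrow> (complex \<Rightarrow> complex ^ 'n) set" where
  "holomorphic_discs X =
     {f. (\<forall>i. (\<lambda>z. f z $ i) holomorphic_on ball 0 1) \<and> f ` ball 0 1 \<subseteq> X}"

text \<open>The constant factor in the Poincare metric depends on the normalisation of the curvature
  (here -4). It only rescales the Kobayashi pseudodistance.\<close>

definition poincare_dist :: "complex \<Rightarrow> complex \<Rightarrow> real" where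
  "poincare_dist a b = artanh (cmod ((a - b) / (1 - cnj b * a)))"

text \<open>Total lengths of the chains of holomorphic discs in \<open>X\<close> joining \<open>x\<close> to \<open>y\<close>: the \<open>j\<close>-th disc
  \<open>f j\<close> maps \<open>a j\<close> to \<open>p j\<close> and \<open>b j\<close> to \<open>p (Suc j)\<close>.\<close>

definition chain_lengths ::
    "(complex ^ 'n) set \<Rightarrow> complex ^ 'n \<Rightarrow> complex ^ 'n \<Rightarrow> real set" where
  "chain_lengths X x y =
     {(\<Sum>j<m. poincare_dist (a j) (b j)) | (m :: nat) p f a b.
        m \<ge> 1 \<and> p 0 = x \<and> p m = y \<and>
        (\<forall>j<m. f j \<in> holomorphic_discs X \<and> a j \<in> ball 0 1 \<and> b j \<in> ball 0 1 \<and>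
               f j (a j) = p j \<and> f j (b j) = p (Suc j))}"

text \<open>Intended for domains \<open>X\<close>, for which \<open>chain_lengths X x y\<close> is nonempty whenever
  \<open>x, y \<in> X\<close>. The value 0 outside \<open>X\<close> is a convention, needed because \<open>Metric_space\<close> requires
  nonnegativity and symmetry on the whole type.\<close>

definition kobayashi_pseudodist ::
    "(complex ^ 'n) set \<Rightarrow> complex ^ 'n \<Rightarrow> complex ^ 'n \<Rightarrow> real" where
  "kobayashi_pseudodist X x y = (if x \<in> X \<and> y \<in> X then Inf (chain_lengths X x y) else 0)"

definition kobayashi_hyperbolic :: "(complex ^ 'n) set \<Rightarrow> bool" where
  "kobayashi_hyperbolic X \<longleftrightarrow> Metric_space X (kobayashi_pseudodist X)"

end

theory Submission
  imports Defs
begin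

text \<open>The points \<open>(a\<^sub>1, a\<^sub>2)\<close> and \<open>(a\<^sub>1 + \<i>, a\<^sub>2)\<close> are at Kobayashi distance 0. The complex line over
  the graph of \<open>\<gamma>\<^sub>k\<close> meets the tube in a strip of width at least \<open>2k\<close>, so moving by \<open>\<i>\<close> in its
  first coordinate costs only \<open>O(1/k)\<close>. The two ends are joined to the given points by vertical discs
  of a fixed radius \<open>r\<close>, at cost \<open>O(1/(kr))\<close>, since the slope of \<open>\<gamma>\<^sub>k\<close> is at most \<open>1/k\<close>.\<close>

text \<open>Continuity of \<open>artanh\<close> at 0. The bound \<delta> \<le> 1 ensures that every
  parameter of modulus below \<delta> lies in the unit disc.\<close>

lemma artanh_small:
  fixes e :: real
  assumes "e > 0"
  obtains \<delta> where "0 < \<delta>" "\<delta> \<le> 1" "\<And>x. 0 \<le> x \<Longrightarrow> x < \<delta> \<Longrightarrow> artanh x < e"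
proof -
  have "isCont (artanh :: real \<Rightarrow> real) 0"
    by (intro continuous_intros) auto
  then obtain d where d: "d > 0" "\<And>x::real. norm (x - 0) < d \<Longrightarrow> norm (artanh x - artanh 0) < e"
    using assms unfolding continuous_at_eps_delta dist_norm by metis
  have "artanh x < e" if "0 \<le> x" "x < min d 1" for x
    using d(2)[of x] that by simp
  with d(1) that[of "min d 1"] show thesis by simp
qed

text \<open>The quotient is the disc automorphism sending \<open>b\<close> to 0, evaluated at
  \<open>a\<close>, so its modulus lies in [0, 1), where \<open>artanh\<close> is
  nonnegative.\<close>

lemma poincare_dist_nonneg:
  assumes "a \<in> ball 0 1" "b \<in> ball 0 1"
  shows "poincare_dist a b \<ge> 0"
proof -
  have "cmod (Moebius_function 0 b a) < 1"
    using assms by (intro Moebius_function_norm_lt_1) auto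
  then have "cmod ((a - b) / (1 - cnj b * a)) < 1"
    by (simp add: Moebius_function_def)
  then show ?thesis
    unfolding poincare_dist_def artanh_def by simp
qed

lemma poincare_dist_0_left: "poincare_dist 0 b = artanh (cmod b)"
  by (simp add: poincare_dist_def)

lemma poincare_dist_0_right: "poincare_dist a 0 = artanh (cmod a)"
  by (simp add: poincare_dist_def)

lemma chain_lengths_nonneg:
  assumes "l \<in> chain_lengths X x y"
  shows "l \<ge> 0"
  using assms unfolding chain_lengths_def by (auto intro!: sum_nonneg poincare_dist_nonneg)

text \<open>The hypothesis also makes the set of lengths nonempty, which the bound
  \<open>Inf\<close> \<ge> 0 requires.\<close>

lemma kobayashi_pseudodist_eq_0I:
  assumes "\<And>e. e > 0 \<Longrightarrow> \<exists>l \<in> chain_lengths X x y. l < e"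
  shows "kobayashi_pseudodist X x y = 0"
proof -
  have bdd: "bdd_below (chain_lengths X x y)"
    using chain_lengths_nonneg by (rule bdd_belowI)
  have "Inf (chain_lengths X x y) \<ge> 0"
    using assms[of 1] chain_lengths_nonneg by (intro cInf_greatest) auto
  moreover have "Inf (chain_lengths X x y) \<le> 0"
  proof (rule field_le_epsilon)
    fix e :: real assume "e > 0"
    then obtain l where "l \<in> chain_lengths X x y" "l < e"
      using assms by blast
    then show "Inf (chain_lengths X x y) \<le> 0 + e"
      using cInf_lower[OF _ bdd] by fastforce
  qed
  ultimately show ?thesis
    by (simp add: kobayashi_pseudodist_def)
qed

lemma three_disc_chain:
  assumes discs: "f \<in> holomorphic_discs X" "g \<in> holomorphic_discs X" "h \<in> holomorphic_discs X"
    and ball: "a1 \<in> ball 0 1" "b1 \<in> ball 0 1" "a2 \<in> ball 0 1" "b2 \<in> ball 0 1"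
      "a3 \<in> ball 0 1" "b3 \<in> ball 0 1"
    and glue: "f b1 = g a2" "g b2 = h a3"
  shows "poincare_dist a1 b1 + poincare_dist a2 b2 + poincare_dist a3 b3
    \<in> chain_lengths X (f a1) (h b3)"
  unfolding chain_lengths_def mem_Collect_eq
  apply (rule exI[of _ 3], rule exI[of _ "\<lambda>j. [f a1, f b1, g b2, h b3] ! j"],
      rule exI[of _ "\<lambda>j. [f, g, h] ! j"],
      rule exI[of _ "\<lambda>j. [a1, a2, a3] ! j"], rule exI[of _ "\<lambda>j. [b1, b2, b3] ! j"])
  using assms by (simp add: eval_nat_numeral All_less_Suc lessThan_Suc)

lemma mem_tube_2: "z \<in> tube D \<longleftrightarrow> vector [Re (z $ 1), Re (z $ 2)] \<in> D"
  for D :: "(real ^ 2) set"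
proof -
  have "(\<chi> i. Re (z $ i)) = (vector [Re (z $ 1), Re (z $ 2)] :: real ^ 2)"
    by (simp add: vec_eq_iff forall_2)
  then show ?thesis
    by (simp add: tube_def)
qed

lemma holomorphic_discs_tube_2I:
  fixes D :: "(real ^ 2) set"
  assumes "g holomorphic_on ball 0 1" "h holomorphic_on ball 0 1"
    and "\<And>z. cmod z < 1 \<Longrightarrow> vector [Re (g z), Re (h z)] \<in> D"
  shows "(\<lambda>z. vector [g z, h z]) \<in> holomorphic_discs (tube D)"
  using assms by (auto simp: holomorphic_discs_def forall_2 mem_tube_2)

text \<open>Supplies the radius of the vertical discs, fixed before \<open>k\<close> is
  chosen.\<close>

lemma open_contains_vertical_segment:
  fixes D :: "(real ^ 2) set" and a :: "real ^ 2"
  assumes "open D" "a \<in> D"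
  obtains r where "r > 0" "\<And>t. \<bar>t\<bar> < r \<Longrightarrow> vector [a $ 1, a $ 2 + t] \<in> D"
proof -
  obtain r where r: "r > 0" "ball a r \<subseteq> D"
    using assms openE by blast
  have "vector [a $ 1, a $ 2 + t] \<in> D" if "\<bar>t\<bar> < r" for t
  proof -
    have "dist a (vector [a $ 1, a $ 2 + t]) = \<bar>t\<bar>"
      by (simp add: dist_vec_def L2_set_def sum_2 dist_real_def)
    with that r show ?thesis by auto
  qed
  with r(1) that show thesis by blast
qed

text \<open>The values at 1 and -1 differ by \<open>2 * c\<close>, and both are within
  \<open>B\<close> of \<open>m\<close>.\<close>

lemma abs_slope_le:
  fixes c d m :: real
  assumes "K \<ge> 1" "\<And>t. t \<in> {-K..K} \<Longrightarrow> \<bar>c * t + d - m\<bar> \<le> B"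
  shows "\<bar>c\<bar> \<le> B"
proof -
  have "\<bar>c * 1 + d - m\<bar> \<le> B" "\<bar>c * (-1) + d - m\<bar> \<le> B"
    by (intro assms(2); use assms(1) in simp)+
  then show ?thesis by (simp add: abs_le_iff)
qed

theorem theorem1p3:
  fixes D :: "(real ^ 2) set"
  assumes "is_domain D"
    and "D \<subseteq> {x. x $ 2 > 0}"
    and "\<exists>a\<in>D. \<forall>k::nat. k \<ge> 1 \<longrightarrow>
           (\<exists>c d :: real. \<forall>t\<in>{- real k..real k}.
              vector [t, c * t + d] \<in> D \<and> \<bar>(c * t + d) - a $ 2\<bar> \<le> 1 / real k)"
  shows "\<not> kobayashi_hyperbolic (tube D)"
proof
  assume "kobayashi_hyperbolic (tube D)"
  then interpret Metric_space "tube D" "kobayashi_pseudodist (tube D)"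
    by (simp add: kobayashi_hyperbolic_def)
  obtain a :: "real ^ 2" where a: "a \<in> D" and graph: "\<And>k::nat. k \<ge> 1 \<Longrightarrow>
           (\<exists>c d :: real. \<forall>t\<in>{- real k..real k}.
              vector [t, c * t + d] \<in> D \<and> \<bar>(c * t + d) - a $ 2\<bar> \<le> 1 / real k)"
    using assms(3) by blast
  have "open D" using assms(1) by (simp add: is_domain_def)
  then obtain r where r: "r > 0" "\<And>t. \<bar>t\<bar> < r \<Longrightarrow> vector [a $ 1, a $ 2 + t] \<in> D"
    using a open_contains_vertical_segment by blast
  define A where "A = complex_of_real (a $ 1)"
  define B where "B = complex_of_real (a $ 2)"
  define x where "x = (vector [A, B] :: complex ^ 2)"
  define y where "y = (vector [A + \<i>, B] :: complex ^ 2)"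
  have "x \<in> tube D" "y \<in> tube D"
    using r(2)[of 0] r(1) by (simp_all add: mem_tube_2 x_def y_def A_def B_def)
  have "x \<noteq> y"
    by (auto simp: x_def y_def vec_eq_iff forall_2)
  have "kobayashi_pseudodist (tube D) x y = 0"
  proof (rule kobayashi_pseudodist_eq_0I)
    fix e :: real assume "e > 0"
    then obtain \<delta> where \<delta>: "0 < \<delta>" "\<delta> \<le> 1" "\<And>x. 0 \<le> x \<Longrightarrow> x < \<delta> \<Longrightarrow> artanh x < e / 3"
      using artanh_small[of "e / 3"] by auto
    \<comment> \<open>The first bound makes the strip wide enough for \<open>1 / R\<close> <
      \<delta>; the second makes the vertical offsets, at most \<open>2 / k\<close>, small relative
      to \<open>r\<close>.\<close>
    obtain k :: nat where k: "real k > max (\<bar>a $ 1\<bar> + 1 / \<delta>) (2 / (\<delta> * r))"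
      using reals_Archimedean2 by blast
    \<comment> \<open>With this radius, the interval of half-width \<open>R\<close> about
      \<open>a $ 1\<close> stays inside [-k, k].\<close>
    define R where "R = real k - \<bar>a $ 1\<bar>"
    have R: "R > 1 / \<delta>" using k by (simp add: R_def)
    have "1 / \<delta> \<ge> 1" using \<delta> by simp
    then have R1: "R \<ge> 1" using R by linarith
    then have k1: "real k \<ge> 1" by (simp add: R_def)
    have "2 / real k < \<delta> * r"
      using k k1 \<delta> r(1) by (simp add: field_simps)
    obtain c d where cd: "\<And>t. t \<in> {- real k..real k} \<Longrightarrow> vector [t, c * t + d] \<in> D"
      "\<And>t. t \<in> {- real k..real k} \<Longrightarrow> \<bar>(c * t + d) - a $ 2\<bar> \<le> 1 / real k"
      using graph[of k] k1 unfolding real_of_nat_ge_one_iff by meson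
    have c: "\<bar>c\<bar> \<le> 1 / real k"
      using abs_slope_le[OF k1 cd(2)] .
    \<comment> \<open>The vertical offset from \<open>x\<close> to the complex line over the graph.
      The offset from \<open>y\<close> is \<open>w + c * \<i>\<close>, since moving by
      \<open>\<i>\<close> in the first coordinate moves the line's second coordinate by
      \<open>c * \<i>\<close>.\<close>
    define w where "w = complex_of_real (c * (a $ 1) + d) - B"
    have "a $ 1 \<in> {- real k..real k}"
      using R1 by (auto simp: R_def abs_if split: if_splits)
    then have w: "cmod w \<le> 1 / real k"
      unfolding w_def B_def of_real_diff[symmetric] norm_of_real by (rule cd(2))
    have "cmod (w + c * \<i>) \<le> 2 / real k"
      using norm_triangle_ineq[of w "c * \<i>"] w c by (simp add: norm_mult)
    \<comment> \<open>Parameters solving \<open>r * b1 = w\<close>, \<open>R * b2 = \<i>\<close> and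
      \<open>r * a3 = w + c * \<i>\<close>, which are the gluing conditions for the three discs
      below.\<close>
    define b1 b2 a3 where "b1 = w / r" and "b2 = \<i> / R" and "a3 = (w + c * \<i>) / r"
    have "cmod w \<le> 2 / real k" using w k1 by (simp add: field_simps)
    then have b1: "cmod b1 < \<delta>"
      using \<open>2 / real k < \<delta> * r\<close> r(1) by (simp add: b1_def norm_divide field_simps)
    have b2: "cmod b2 < \<delta>"
      using R R1 \<delta> by (simp add: b2_def norm_divide field_simps)
    have a3: "cmod a3 < \<delta>"
      using \<open>2 / real k < \<delta> * r\<close> r(1) \<open>cmod (w + c * \<i>) \<le> 2 / real k\<close>
      by (simp add: a3_def norm_divide field_simps)
    \<comment> \<open>\<open>f\<close> goes vertically from \<open>x\<close> to the complex line,
      \<open>g\<close> runs along that line, and \<open>h\<close> is the vertical disc centred at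
      \<open>y\<close>.\<close>
    define f where "f = (\<lambda>z::complex. vector [A, B + r * z] :: complex ^ 2)"
    define g where "g = (\<lambda>z::complex. vector [A + R * z, c * (A + R * z) + d] :: complex ^ 2)"
    define h where "h = (\<lambda>z::complex. vector [A + \<i>, B + r * z] :: complex ^ 2)"
    have vertical: "vector [a $ 1, a $ 2 + r * Re z] \<in> D" if "cmod z < 1" for z
      using r abs_Re_le_cmod[of z] that by (intro r(2)) (simp add: abs_mult)
    have f: "f \<in> holomorphic_discs (tube D)" and h: "h \<in> holomorphic_discs (tube D)"
      unfolding f_def h_def
      by (intro holomorphic_discs_tube_2I holomorphic_intros; simp add: A_def B_def vertical)+
    have g: "g \<in> holomorphic_discs (tube D)"
      unfolding g_def
    proof (intro holomorphic_discs_tube_2I holomorphic_intros)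
      fix z assume "cmod z < 1"
      then have "\<bar>R * Re z\<bar> \<le> R"
        using R1 abs_Re_le_cmod[of z] by (simp add: abs_mult mult_left_le)
      then have "a $ 1 + R * Re z \<in> {- real k..real k}"
        unfolding R_def by (auto simp: abs_le_iff)
      from cd(1)[OF this]
      show "vector [Re (A + R * z), Re (c * (A + R * z) + d)] \<in> D"
        by (simp add: A_def)
    qed
    have "r * b1 = w" "R * b2 = \<i>" "r * a3 = w + c * \<i>"
      using r(1) R1 by (simp_all add: b1_def b2_def a3_def)
    then have "f b1 = g 0" "g b2 = h a3"
      unfolding f_def g_def h_def by (simp_all add: w_def A_def distrib_left add_ac)
    \<comment> \<open>The last disc is traversed backwards, from \<open>a3\<close> to its centre.
      Each disc thus has 0 as one of its two parameters, and its length is \<open>artanh\<close> of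
      the modulus of the other.\<close>
    then have "poincare_dist 0 b1 + poincare_dist 0 b2 + poincare_dist a3 0
        \<in> chain_lengths (tube D) (f 0) (h 0)"
      using b1 b2 a3 \<delta>(2) by (intro three_disc_chain[OF f g h]) auto
    moreover have "poincare_dist 0 b1 + poincare_dist 0 b2 + poincare_dist a3 0 < e"
      unfolding poincare_dist_0_left poincare_dist_0_right
      using \<delta>(3)[OF _ b1] \<delta>(3)[OF _ b2] \<delta>(3)[OF _ a3] by simp
    ultimately show "\<exists>l \<in> chain_lengths (tube D) x y. l < e"
      by (auto simp: f_def h_def x_def y_def)
  qed
  with zero[OF \<open>x \<in> tube D\<close> \<open>y \<in> tube D\<close>] \<open>x \<noteq> y\<close> show False
    by simp
qed

end
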